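(* Let $0<f<1$ and $R>0$. Suppose a large rollup with arrival rate $R$ and a small rollup with arrival rate $Rf$ both post blobs in an equilibrium with blob price $B$, and let $B^N$ be the blob price in an equilibrium after these two rollups join in posting blobs. Let $B_1$ be the Nash bargaining payment of the large rollup towards the joint blob, and let $I_{L,B_1}$, $I_{S,B_1}$ be the resulting relative improvements of the per-transaction costs of the large and the small rollup. Then $$I_{L,B_1}\le I_{S,B_1}.$$
   Context: Fixed parameters: $a,G,P_1>0$ and a target $k>0$ of blobs per time unit; metadata costs are zero ($P_0=0$). At blob price $B$, a rollup with transaction arrival rate $R>0$ has optimal cost per transaction $\sqrt{2Ba/R}$ when posting blobs (posting every $\sqrt{2B/(aR)}$ time units) and $P_1G$ when posting directly on the L1 main market. Each rollup uses the cheaper strategy (either one in case of a tie). An equilibrium for a finite family of rollups with rates $(R_l)_{l\in I}$, $R_l>0$, is a pair $(B,S)$ with blob price $B>0$ and set $\emptyset\ne S\subseteq I$ of blob-posting rollups such that $B=\frac{a}{2k^2}\bigl(\sum_{l\in S}\sqrt{R_l}\bigr)^2$ (the target of $k$ blobs per time unit is met), $\sqrt{2Ba/R_l}\le P_1G$ for $l\in S$, and $\sqrt{2Ba/R_l}\ge P_1G$ for $l\in I\setminus S$. When two rollups join in posting blobs they are replaced by a single rollup whose rate is the sum of their rates; an equilibrium after joining is an equilibrium $(B^N,S^N)$ of the new family in which the joint rollup belongs to $S^N$. There may be any finite number of other rollups. Cost sharing. Posting alone at price $B$, the per-transaction costs are $Tr_L=\sqrt{2Ba/R}$ (large) and $Tr_S=\sqrt{2Ba/(Rf)}$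 (small). A joint blob is posted every $t_J=\sqrt{\frac{2B^N}{(1+f)aR}}$ time units and contains $C_J=\sqrt{2B^NR(1+f)/a}$ transactions, of which $C_{J,L}=\frac{C_J}{1+f}$ are from the large and $C_{J,S}=\frac{fC_J}{1+f}$ from the small rollup. The total delay costs per joint blob are $d_{J,L}=\frac{aRt_J^2}{2}$ and $d_{J,S}=\frac{aRft_J^2}{2}$. If the large rollup pays $B_1$ and the small rollup pays $B^N-B_1$ of the joint blob price, the Nash bargaining payment $B_1$ is the maximizer over $B_1$ of the (rescaled) Nash product $$(B_1+d_{J,L}-C_{J,L}Tr_L)(B^N-B_1+d_{J,S}-C_{J,S}Tr_S),$$ that is, $B_1=\tfrac12\bigl(B^N+d_{J,S}-d_{J,L}-C_{J,S}Tr_S+C_{J,L}Tr_L\bigr)$. The effective per-transaction costs after joining are $Tr_{J,L,B_1}=(B_1+d_{J,L})/C_{J,L}$ and $Tr_{J,S,B_1}=(B^N-B_1+d_{J,S})/C_{J,S}$, and the improvement of rollup $X\in\{L,S\}$ is $I_{X,B_1}=1-Tr_{J,X,B_1}/Tr_X$. *)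

theory Defs
  imports Complex_Main
begin

text \<open>Metadata costs are zero throughout. Posting every \<open>sqrt (2 * B / (a * r))\<close> time units is
  optimal for a blob-posting rollup of rate \<open>r\<close> and yields the cost \<open>blob_cost a B r\<close> per
  transaction; posting on the L1 main market costs \<open>P1 * G\<close> per transaction.\<close>

definition blob_cost :: "real \<Rightarrow> real \<Rightarrow> real \<Rightarrow> real" where
  "blob_cost a B r = sqrt (2 * B * a / r)"

text \<open>The family of rollups is given by an index set \<open>I\<close> and rates \<open>r\<close>; values of \<open>r\<close> outside \<open>I\<close>
  are irrelevant. The equation for \<open>B\<close> says that \<open>k\<close> blobs are posted per time unit. The
  inequalities are weak on both sides because a rollup may choose either strategy in a tie.\<close>

definition equilibrium ::
  "real \<Rightarrow> real \<Rightarrow> real \<Rightarrow> real \<Rightarrow> 'i set \<Rightarrow> ('i \<Rightarrow> real) \<Rightarrow> real \<Rightarrow> 'i set \<Rightarrow> bool" where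
  "equilibrium a G P1 k I r B S \<longleftrightarrow>
     B > 0 \<and> S \<noteq> {} \<and> S \<subseteq> I \<and>
     B = a / (2 * k\<^sup>2) * (\<Sum>l\<in>S. sqrt (r l))\<^sup>2 \<and>
     (\<forall>l\<in>S. blob_cost a B (r l) \<le> P1 * G) \<and>
     (\<forall>l\<in>I - S. blob_cost a B (r l) \<ge> P1 * G)"

text \<open>When \<open>i\<close> and \<open>j\<close> join, the joint rollup takes over the index \<open>i\<close>, and \<open>j\<close> is removed.\<close>

definition joined_index :: "'i \<Rightarrow> 'i set \<Rightarrow> 'i set" where
  "joined_index j I = I - {j}"

definition joined_rate :: "'i \<Rightarrow> 'i \<Rightarrow> ('i \<Rightarrow> real) \<Rightarrow> 'i \<Rightarrow> real" where
  "joined_rate i j r = r(i := r i + r j)"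

definition joint_equilibrium ::
  "real \<Rightarrow> real \<Rightarrow> real \<Rightarrow> real \<Rightarrow> 'i set \<Rightarrow> ('i \<Rightarrow> real) \<Rightarrow> 'i \<Rightarrow> 'i \<Rightarrow> real \<Rightarrow> 'i set \<Rightarrow> bool" where
  "joint_equilibrium a G P1 k I r i j BN SN \<longleftrightarrow>
     equilibrium a G P1 k (joined_index j I) (joined_rate i j r) BN SN \<and> i \<in> SN"

text \<open>Below, the large rollup has rate \<open>R\<close> and the small one rate \<open>R * f\<close>; \<open>B\<close> and \<open>BN\<close> are the
  blob prices before and after joining.\<close>

definition joint_time :: "real \<Rightarrow> real \<Rightarrow> real \<Rightarrow> real \<Rightarrow> real" where
  "joint_time a R f BN = sqrt (2 * BN / ((1 + f) * a * R))"

definition joint_count :: "real \<Rightarrow> real \<Rightarrow> real \<Rightarrow> real \<Rightarrow> real" where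
  "joint_count a R f BN = sqrt (2 * BN * R * (1 + f) / a)"

definition joint_count_large :: "real \<Rightarrow> real \<Rightarrow> real \<Rightarrow> real \<Rightarrow> real" where
  "joint_count_large a R f BN = joint_count a R f BN / (1 + f)"

definition joint_count_small :: "real \<Rightarrow> real \<Rightarrow> real \<Rightarrow> real \<Rightarrow> real" where
  "joint_count_small a R f BN = f * joint_count a R f BN / (1 + f)"

text \<open>A rollup of rate \<open>r\<close> incurs delay costs \<open>a * r * t\<^sup>2 / 2\<close> per period of length \<open>t\<close>.\<close>

definition joint_delay_large :: "real \<Rightarrow> real \<Rightarrow> real \<Rightarrow> real \<Rightarrow> real" where
  "joint_delay_large a R f BN = a * R * (joint_time a R f BN)\<^sup>2 / 2"

definition joint_delay_small :: "real \<Rightarrow> real \<Rightarrow> real \<Rightarrow> real \<Rightarrow> real" where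
  "joint_delay_small a R f BN = a * R * f * (joint_time a R f BN)\<^sup>2 / 2"

text \<open>Each factor is joint minus individual cost, i.e. minus the gain of the respective rollup,
  so the product is the product of the two gains.\<close>

definition nash_product :: "real \<Rightarrow> real \<Rightarrow> real \<Rightarrow> real \<Rightarrow> real \<Rightarrow> real \<Rightarrow> real" where
  "nash_product a R f B BN x =
     (x + joint_delay_large a R f BN - joint_count_large a R f BN * blob_cost a B R) *
     (BN - x + joint_delay_small a R f BN - joint_count_small a R f BN * blob_cost a B (R * f))"

text \<open>The payment ranges over all reals; the product is a strictly concave quadratic in it, so
  the maximizer exists and is unique.\<close>

definition is_nash_payment :: "real \<Rightarrow> real \<Rightarrow> real \<Rightarrow> real \<Rightarrow> real \<Rightarrow> real \<Rightarrow> bool" where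
  "is_nash_payment a R f B BN B1 \<longleftrightarrow> is_arg_max (nash_product a R f B BN) (\<lambda>_. True) B1"

definition joint_cost_large :: "real \<Rightarrow> real \<Rightarrow> real \<Rightarrow> real \<Rightarrow> real \<Rightarrow> real" where
  "joint_cost_large a R f BN B1 =
     (B1 + joint_delay_large a R f BN) / joint_count_large a R f BN"

definition joint_cost_small :: "real \<Rightarrow> real \<Rightarrow> real \<Rightarrow> real \<Rightarrow> real \<Rightarrow> real" where
  "joint_cost_small a R f BN B1 =
     (BN - B1 + joint_delay_small a R f BN) / joint_count_small a R f BN"

definition improvement_large :: "real \<Rightarrow> real \<Rightarrow> real \<Rightarrow> real \<Rightarrow> real \<Rightarrow> real \<Rightarrow> real" where
  "improvement_large a R f B BN B1 = 1 - joint_cost_large a R f BN B1 / blob_cost a B R"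

definition improvement_small :: "real \<Rightarrow> real \<Rightarrow> real \<Rightarrow> real \<Rightarrow> real \<Rightarrow> real \<Rightarrow> real" where
  "improvement_small a R f B BN B1 = 1 - joint_cost_small a R f BN B1 / blob_cost a B (R * f)"

end

theory Submission
  imports Defs
begin

text \<open>Joining cannot raise the blob price. At a higher price, every other rollup that still posts
  blobs also posted them before, and the joint rollup contributes
  \<open>sqrt (R + R * f) \<le> sqrt R + sqrt (R * f)\<close> to the sum that determines the price. Hence the
  total gain from joining is nonnegative. Nash bargaining splits it equally, and the common gain is
  measured against the costs per joint blob when posting alone, which are larger for the large
  rollup by the factor \<open>1 / sqrt f\<close>.\<close>

lemma blob_cost_strict_mono:
  assumes "a > 0" "r > 0" "B < B'"
  shows "blob_cost a B r < blob_cost a B' r"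
  using assms by (simp add: blob_cost_def divide_strict_right_mono)

lemma joint_price_le:
  assumes "a > 0" "finite I" and pos: "\<And>l. l \<in> I \<Longrightarrow> r l > 0" and "i \<noteq> j"
    and eq: "equilibrium a G P1 k I r B S" and iS: "i \<in> S" and jS: "j \<in> S"
    and joint: "joint_equilibrium a G P1 k I r i j BN SN"
  shows "BN \<le> B"
proof (rule ccontr)
  assume "\<not> BN \<le> B"
  then have less: "B < BN" by simp
  have SI: "S \<subseteq> I" and B: "B = a / (2 * k\<^sup>2) * (\<Sum>l\<in>S. sqrt (r l))\<^sup>2"
    and out: "\<And>l. l \<in> I - S \<Longrightarrow> P1 * G \<le> blob_cost a B (r l)"
    using eq by (auto simp: equilibrium_def)
  let ?r = "joined_rate i j r"
  have iN: "i \<in> SN" and SNI: "SN \<subseteq> I - {j}"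
    and BN: "BN = a / (2 * k\<^sup>2) * (\<Sum>l\<in>SN. sqrt (?r l))\<^sup>2"
    and inN: "\<And>l. l \<in> SN \<Longrightarrow> blob_cost a BN (?r l) \<le> P1 * G"
    using joint by (auto simp: joint_equilibrium_def equilibrium_def joined_index_def)
  have finS: "finite S" and finSN: "finite SN"
    using SI SNI \<open>finite I\<close> by (auto intro: finite_subset)
  have r_nonneg: "0 \<le> r l" if "l \<in> I" for l
    using pos[OF that] by simp
  have sub: "SN - {i} \<subseteq> S - {i} - {j}"
  proof
    fix l assume l: "l \<in> SN - {i}"
    then have lI: "l \<in> I" "l \<noteq> j" using SNI by auto
    \<comment> \<open>Strictness matters: both equilibrium conditions are weak, so a rollup outside
      \<open>S\<close> could be exactly indifferent at \<open>B\<close>. Being strictly cheaper at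
      \<open>B\<close> than at \<open>BN\<close>, where its cost is at most \<open>P1 * G\<close>,
      forces it into \<open>S\<close>.\<close>
    have "blob_cost a B (r l) < blob_cost a BN (r l)"
      using blob_cost_strict_mono \<open>a > 0\<close> pos lI less by blast
    also have "\<dots> \<le> P1 * G"
      using inN[of l] l by (simp add: joined_rate_def)
    finally show "l \<in> S - {i} - {j}"
      using out[of l] l lI by force
  qed
  have "(\<Sum>l\<in>SN. sqrt (?r l)) = sqrt (r i + r j) + (\<Sum>l\<in>SN - {i}. sqrt (r l))"
    using finSN iN by (simp add: sum.remove joined_rate_def)
  also have "\<dots> \<le> sqrt (r i) + sqrt (r j) + (\<Sum>l\<in>S - {i} - {j}. sqrt (r l))"
    using iS jS SI finS sub r_nonneg
    by (intro add_mono sqrt_add_le_add_sqrt sum_mono2) auto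
  also have "\<dots> = (\<Sum>l\<in>S. sqrt (r l))"
    using finS iS jS \<open>i \<noteq> j\<close> by (simp add: sum.remove[of S i] sum.remove[of "S - {i}" j])
  finally have sum_le: "(\<Sum>l\<in>SN. sqrt (?r l)) \<le> (\<Sum>l\<in>S. sqrt (r l))" .
  have "0 \<le> (\<Sum>l\<in>SN. sqrt (?r l))"
    using SNI iS jS SI r_nonneg by (intro sum_nonneg) (auto simp: joined_rate_def subset_iff)
  then have "BN \<le> B"
    unfolding B BN using sum_le \<open>a > 0\<close> by (intro mult_left_mono power_mono) auto
  with less show False by simp
qed

text \<open>At the optimal posting interval the total delay cost of a joint blob equals its price
  \<open>BN\<close>; it splits in proportion to the rates, 1 to \<open>f\<close>.\<close>

lemma joint_delay_large_eq:
  assumes "a > 0" "R > 0" "f > 0" "BN > 0"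
  shows "joint_delay_large a R f BN = BN / (1 + f)"
  using assms by (simp add: joint_delay_large_def joint_time_def frac_eq_eq)

lemma joint_delay_small_eq:
  assumes "a > 0" "R > 0" "f > 0" "BN > 0"
  shows "joint_delay_small a R f BN = f * BN / (1 + f)"
  using assms by (simp add: joint_delay_small_def joint_time_def frac_eq_eq)

text \<open>The count grows like \<open>sqrt (R / a)\<close> and the cost per transaction like
  \<open>sqrt (a / R)\<close>, so only the two prices and \<open>f\<close> survive.\<close>

lemma single_cost_large_eq:
  assumes "a > 0" "R > 0" "f > 0" "B > 0" "BN > 0"
  shows "joint_count_large a R f BN * blob_cost a B R = 2 * sqrt (B * BN) / sqrt (1 + f)"
proof -
  have "joint_count a R f BN * blob_cost a B R
      = sqrt (2 * BN * R * (1 + f) / a * (2 * B * a / R))"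
    by (simp only: joint_count_def blob_cost_def real_sqrt_mult)
  also have "2 * BN * R * (1 + f) / a * (2 * B * a / R) = 2\<^sup>2 * (B * BN) * (1 + f)"
    using assms by (simp add: field_simps)
  also have "sqrt \<dots> = 2 * sqrt (B * BN) * sqrt (1 + f)"
    by (simp only: real_sqrt_mult real_sqrt_abs abs_numeral)
  finally have "joint_count a R f BN * blob_cost a B R = 2 * sqrt (B * BN) * sqrt (1 + f)" .
  then have "joint_count_large a R f BN * blob_cost a B R
      = 2 * sqrt (B * BN) * (sqrt (1 + f) / (1 + f))"
    by (simp add: joint_count_large_def)
  then show ?thesis
    using assms by (simp add: sqrt_divide_self_eq) (simp add: divide_inverse)
qed

text \<open>The small rollup supplies \<open>f\<close> times as many transactions, each
  \<open>1 / sqrt f\<close> times as expensive when posted alone.\<close>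

lemma single_cost_small_eq:
  assumes "f > 0"
  shows "joint_count_small a R f BN * blob_cost a B (R * f)
    = sqrt f * (joint_count_large a R f BN * blob_cost a B R)"
proof -
  have "f * blob_cost a B (R * f) = f / sqrt f * blob_cost a B R"
    by (simp add: blob_cost_def real_sqrt_divide real_sqrt_mult mult_ac)
  then have "f * blob_cost a B (R * f) = sqrt f * blob_cost a B R"
    using assms by (simp add: real_div_sqrt)
  then show ?thesis
    by (simp add: joint_count_small_def joint_count_large_def mult.assoc mult.left_commute)
qed

text \<open>The two factors of the Nash product have a sum independent of the payment, so their
  product is largest where they coincide. The signs of the gains do not enter.\<close>

lemma nash_payment_equal_gains:
  assumes "is_nash_payment a R f B BN B1"
  shows "joint_count_large a R f BN * blob_cost a B R - (B1 + joint_delay_large a R f BN)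
    = joint_count_small a R f BN * blob_cost a B (R * f) - (BN - B1 + joint_delay_small a R f BN)"
proof -
  define p where "p = joint_count_large a R f BN * blob_cost a B R - joint_delay_large a R f BN"
  define q where
    "q = BN + joint_delay_small a R f BN - joint_count_small a R f BN * blob_cost a B (R * f)"
  have prod: "nash_product a R f B BN x = (x - p) * (q - x)" for x
    by (simp add: nash_product_def p_def q_def algebra_simps)
  \<comment> \<open>Comparing with the midpoint of the zeros suffices: there the product exceeds its
    value at \<open>B1\<close> by exactly \<open>(B1 - (p + q) / 2)\<^sup>2\<close>.\<close>
  have "nash_product a R f B BN ((p + q) / 2) \<le> nash_product a R f B BN B1"
    using assms by (simp add: is_nash_payment_def is_arg_max_linorder)
  then have "(B1 - (p + q) / 2)\<^sup>2 \<le> 0"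
    by (simp add: prod power2_eq_square field_simps)
  then have "B1 = (p + q) / 2" by simp
  then show ?thesis by (simp add: p_def q_def)
qed

theorem proposition8:
  fixes a G P1 k R f B BN B1 :: real
    and I S SN :: "'i set" and r :: "'i \<Rightarrow> real" and i j :: 'i
  assumes "a > 0" and "G > 0" and "P1 > 0" and "k > 0"
    and "0 < f" and "f < 1" and "R > 0"
    and "finite I" and "\<And>l. l \<in> I \<Longrightarrow> r l > 0"
    and "i \<noteq> j" and "r i = R" and "r j = R * f"
    and "equilibrium a G P1 k I r B S" and "i \<in> S" and "j \<in> S"
    and "joint_equilibrium a G P1 k I r i j BN SN"
    and "is_nash_payment a R f B BN B1"
  shows "improvement_large a R f B BN B1 \<le> improvement_small a R f B BN B1"
proof -
  have BN_le: "BN \<le> B"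
    using joint_price_le assms by metis
  have B: "B > 0" and BN: "BN > 0"
    using assms by (auto simp: equilibrium_def joint_equilibrium_def)
  define cL where "cL = joint_count_large a R f BN * blob_cost a B R"
  define cS where "cS = joint_count_small a R f BN * blob_cost a B (R * f)"
  define g where "g = cL - (B1 + joint_delay_large a R f BN)"
  have g_small: "g = cS - (BN - B1 + joint_delay_small a R f BN)"
    using nash_payment_equal_gains assms unfolding g_def cL_def cS_def by blast
  have cL: "cL = 2 * sqrt (B * BN) / sqrt (1 + f)"
    using single_cost_large_eq assms B BN by (simp add: cL_def)
  have cS: "cS = sqrt f * cL"
    using single_cost_small_eq assms by (simp add: cS_def cL_def)
  have cL_pos: "cL > 0" using cL B BN \<open>0 < f\<close> by simp
  have cS_pos: "cS > 0" using cS cL_pos \<open>0 < f\<close> by simp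
  have cS_le: "cS \<le> cL"
    using cS cL_pos \<open>0 < f\<close> \<open>f < 1\<close> by (simp add: mult_left_le_one_le)
  have "joint_delay_large a R f BN + joint_delay_small a R f BN = BN"
    using assms BN
    by (simp add: joint_delay_large_eq joint_delay_small_eq add_divide_distrib[symmetric])
       (simp add: field_simps)
  \<comment> \<open>Adding the two expressions for the common gain \<open>g\<close> eliminates
    \<open>B1\<close>; the joint blob costs \<open>BN\<close> in price and \<open>BN\<close> in
    delay.\<close>
  then have g: "2 * g = cL + cS - 2 * BN"
    using g_def g_small by linarith
  have "BN \<le> sqrt (B * BN)"
    using BN BN_le by (intro real_le_rsqrt) (simp add: power2_eq_square)
  \<comment> \<open>The factor is at least 1 by subadditivity of the square root: joining saves
    costs even at an unchanged price.\<close>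
  also have "\<dots> \<le> sqrt (B * BN) * ((1 + sqrt f) / sqrt (1 + f))"
    using B BN \<open>0 < f\<close> sqrt_add_le_add_sqrt[of 1 f]
    by (simp add: mult_le_cancel_left1 le_divide_eq)
  also have "\<dots> = (cL + cS) / 2"
    by (simp add: cS cL add_divide_distrib ring_distribs)
  finally have "2 * BN \<le> cL + cS"
    by simp
  with g have "0 \<le> g" by simp
  have "improvement_large a R f B BN B1 = g / cL"
    using cL_pos by (simp add: improvement_large_def joint_cost_large_def g_def
        diff_divide_distrib flip: cL_def)
  \<comment> \<open>The sign of \<open>g\<close> decides the direction here, which is why the price
    comparison is needed.\<close>
  also have "\<dots> \<le> g / cS"
    using \<open>0 \<le> g\<close> cS_le cS_pos cL_pos by (simp add: divide_left_mono)
  also have "\<dots> = improvement_small a R f B BN B1"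
    using cS_pos by (simp add: improvement_small_def joint_cost_small_def g_small
        diff_divide_distrib flip: cS_def)
  finally show ?thesis .
qed

end
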